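(* Let $1\le p\le\infty$, and interpret $(2\pi)^{1/p}$ as $1$ when $p=\infty$. If $u\in h^{\mathcal{HK}}$ then $$\|u_r\|_p\le(2\pi)^{1/p}\,\frac{2r\,\|u\|_{\mathcal{HK}}}{\pi(1-r)}\quad\text{for } 1/2\le r<1,$$ and $$\|u_r\|_p\le(2\pi)^{1/p}\,\frac{2\,\|u\|_{\mathcal{HK}}}{\pi}\quad\text{for } 0\le r\le1/2.$$ The order relation $\|u_r\|_p=O(1/(1-r))$ is sharp as $r\to1$: for every $\psi:[0,1)\to(0,\infty)$ with $\psi(r)=o(1/(1-r))$ as $r\to1$ there is $u\in h^{\mathcal{HK}}$ such that $\|u_r\|_p\ne o(\psi(r))$ as $r\to1$.
   Context: $D$ is the open unit disc in $\mathbb{R}^2$; for $u:D\to\mathbb{R}$ write $u_r(\theta)=u(re^{i\theta})$. The Alexiewicz norm of a $2\pi$-periodic function $g:\mathbb{R}\to\mathbb{R}$ is $\|g\|:=\sup_I|\int_I g|$, the supremum being over intervals $I\subset\mathbb{R}$ of length at most $2\pi$. $h^{\mathcal{HK}}:=\{u:D\to\mathbb{R}\mid \Delta u=0 \text{ in } D,\ \sup_{0\le r<1}\|u_r\|<\infty\}$, with norm $\|u\|_{\mathcal{HK}}:=\sup_{0\le r<1}\|u_r\|$. $\|\cdot\|_p$ is the $L^p$ norm with respect to Lebesgue measure on $[-\pi,\pi]$. Limits $r\to1$ are from below. *)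

theory Defs
  imports
    "HOL-Analysis.Analysis"
    "HOL-Probability.Essential_Supremum"
    "HOL-Library.Landau_Symbols"
begin

definition C1_on :: "'a::euclidean_space set \<Rightarrow> ('a \<Rightarrow> real) \<Rightarrow> bool" where
  "C1_on S f \<longleftrightarrow>
     (\<forall>z\<in>S. f differentiable (at z)) \<and>
     (\<forall>v. continuous_on S (\<lambda>z. frechet_derivative f (at z) v))"

definition C2_on :: "'a::euclidean_space set \<Rightarrow> ('a \<Rightarrow> real) \<Rightarrow> bool" where
  "C2_on S f \<longleftrightarrow> C1_on S f \<and> (\<forall>v. C1_on S (\<lambda>z. frechet_derivative f (at z) v))"

definition laplacian :: "('a::euclidean_space \<Rightarrow> real) \<Rightarrow> 'a \<Rightarrow> real" where
  "laplacian f z =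
     (\<Sum>b\<in>Basis. frechet_derivative (\<lambda>w. frechet_derivative f (at w) b) (at z) b)"

text \<open>Only used for open \<open>S\<close>: the derivatives are then determined by the values on \<open>S\<close>.\<close>

definition harmonic_on :: "'a::euclidean_space set \<Rightarrow> ('a \<Rightarrow> real) \<Rightarrow> bool" where
  "harmonic_on S f \<longleftrightarrow> C2_on S f \<and> (\<forall>z\<in>S. laplacian f z = 0)"

definition circle_slice :: "(complex \<Rightarrow> real) \<Rightarrow> real \<Rightarrow> real \<Rightarrow> real" where
  "circle_slice u r \<theta> = u (complex_of_real r * cis \<theta>)"

text \<open>
  The integral is the Henstock--Kurzweil integral. Norms take values in \<open>ennreal\<close>, so that
  a supremum or an integral that is not finite is \<open>\<infinity>\<close>.
\<close>

definition alexiewicz_norm :: "(real \<Rightarrow> real) \<Rightarrow> ennreal" where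
  "alexiewicz_norm g =
     (SUP I\<in>{I. is_interval I \<and> emeasure lborel I \<le> ennreal (2 * pi)}.
        ennreal \<bar>integral I g\<bar>)"

definition HK_norm :: "(complex \<Rightarrow> real) \<Rightarrow> ennreal" where
  "HK_norm u = (SUP r\<in>{0..<1}. alexiewicz_norm (circle_slice u r))"

text \<open>
  The unit disc is a subset of the type \<open>complex\<close>, the Euclidean plane; values of \<open>u\<close> outside
  the disc are irrelevant.
\<close>

definition h_HK :: "(complex \<Rightarrow> real) set" where
  "h_HK = {u. harmonic_on (ball 0 1) u \<and> HK_norm u < \<infinity>}"

definition Lp_norm :: "ennreal \<Rightarrow> (real \<Rightarrow> real) \<Rightarrow> ennreal" where
  "Lp_norm p g =
     (if p = \<infinity> then esssup (lebesgue_on {-pi..pi}) (\<lambda>\<theta>. ennreal \<bar>g \<theta>\<bar>)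
      else (let J = (\<integral>\<^sup>+\<theta>. ennreal (\<bar>g \<theta>\<bar> powr enn2real p) \<partial>lebesgue_on {-pi..pi})
            in if J = \<infinity> then \<infinity> else ennreal (enn2real J powr (1 / enn2real p))))"

definition two_pi_root :: "ennreal \<Rightarrow> real" where
  "two_pi_root p = (if p = \<infinity> then 1 else (2 * pi) powr (1 / enn2real p))"

end

theory Submission
  imports Defs "HOL-Complex_Analysis.Complex_Analysis"
begin

text \<open>
  A harmonic function on the disc is the real part of a holomorphic function, so Cauchy's formula
  yields the Poisson integral over circles of radius \<open>R < 1\<close>. The Poisson kernel is symmetric about
  and decreasing away from its peak; integrating by parts against the integrals of \<open>u\<close> over
  arcs centred at the peak, each bounded by the norm of \<open>u\<close>, shows that \<open>\<bar>u\<bar>\<close> is at most the norm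
  times the peak value, which is \<open>(1 + r) / (2 * pi * (1 - r))\<close> in the limit. This pointwise bound
  implies both upper estimates for every \<open>p\<close>.

  For sharpness take \<open>u(z) = Re (\<Sum>k. 2\<^sup>-\<^sup>k * n\<^sub>k * z ^ n\<^sub>k)\<close>. On circles it is the angular derivative of
  a function bounded by \<open>2\<close>, whereas its \<open>m\<close>-th coefficient forces its \<open>L\<^sup>1\<close> norm at
  \<open>r = 1 - 1 / (2 * n\<^sub>m)\<close> to be at least a constant times \<open>2\<^sup>-\<^sup>m / (1 - r)\<close>. Letting \<open>n\<^sub>m\<close> grow fast enough
  makes this exceed a multiple of \<open>\<psi> r\<close>.
\<close>

subsection \<open>Harmonic functions as real parts of holomorphic functions\<close>

lemma C1_onD:
  assumes "C1_on S f" "z \<in> S"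
  shows "(f has_derivative frechet_derivative f (at z)) (at z)"
  using assms unfolding C1_on_def by (simp add: frechet_derivative_works)

text \<open>Two applications of the mean value theorem, first along \<open>a\<close>, then along
  \<open>b\<close>, turn the quotient into the mixed derivative at a nearby point
  \<open>z + \<xi> *\<^sub>R a + \<eta> *\<^sub>R b\<close>; continuity of that derivative gives the
  limit.\<close>

lemma second_difference_tendsto:
  fixes u :: "'a::euclidean_space \<Rightarrow> real"
  assumes S: "open S" "z \<in> S" and u: "C1_on S u"
    and ua: "C1_on S (\<lambda>w. frechet_derivative u (at w) a)"
  shows "((\<lambda>t. (u (z + t *\<^sub>R a + t *\<^sub>R b) - u (z + t *\<^sub>R a) - u (z + t *\<^sub>R b) + u z) / t\<^sup>2)
           \<longlongrightarrow> frechet_derivative (\<lambda>w. frechet_derivative u (at w) a) (at z) b) (at_right 0)"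
    (is "((\<lambda>t. ?\<Delta> t / t\<^sup>2) \<longlongrightarrow> ?L) _")
proof (rule tendstoI)
  fix e :: real assume "e > 0"
  define Da where "Da = (\<lambda>w. frechet_derivative u (at w) a)"
  define Dab where "Dab = (\<lambda>w. frechet_derivative Da (at w) b)"
  have "continuous_on S Dab"
    using ua unfolding C1_on_def Dab_def Da_def by blast
  then have "isCont Dab z"
    using S continuous_on_eq_continuous_at by blast
  then have "\<forall>\<^sub>F w in nhds z. dist (Dab w) (Dab z) < e"
    using \<open>e > 0\<close> tendstoD isCont_def tendsto_at_iff_tendsto_nhds by blast
  then obtain d where d: "d > 0" "\<And>w. dist w z < d \<Longrightarrow> dist (Dab w) (Dab z) < e"
    by (auto simp: eventually_nhds_metric)
  obtain d' where d': "d' > 0" "ball z d' \<subseteq> S"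
    using S open_contains_ball by blast
  \<comment> \<open>Parameters below \<open>m\<close> keep the points both in \<open>S\<close> and
    in the continuity neighbourhood; the summand \<open>1\<close> keeps the denominator positive
    when \<open>a\<close> and \<open>b\<close> vanish.\<close>
  define m where "m = min d d' / (norm a + norm b + 1)"
  have m: "m > 0"
    using d d' by (auto simp: m_def intro!: divide_pos_pos add_nonneg_pos)
  have close: "dist (z + s *\<^sub>R a + t *\<^sub>R b) z < min d d'"
    if "\<bar>s\<bar> < m" "\<bar>t\<bar> < m" for s t
  proof -
    have "dist (z + s *\<^sub>R a + t *\<^sub>R b) z \<le> \<bar>s\<bar> * norm a + \<bar>t\<bar> * norm b"
      by (simp add: dist_norm norm_triangle_le add.assoc)
    also have "\<dots> \<le> m * norm a + m * norm b"
      using that by (intro add_mono mult_right_mono) auto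
    also have "\<dots> < m * (norm a + norm b + 1)"
      using m by (simp add: algebra_simps)
    also have "\<dots> = min d d'"
      unfolding m_def using add_nonneg_pos[of "norm a + norm b" 1] by (simp)
    finally show ?thesis .
  qed
  then have inS: "z + s *\<^sub>R a + t *\<^sub>R b \<in> S" if "\<bar>s\<bar> < m" "\<bar>t\<bar> < m" for s t
    using that d' by (auto simp: dist_commute subset_eq)
  have "dist (?\<Delta> t / t\<^sup>2) ?L < e" if t: "0 < t" "t < m" for t
  proof -
    define g where "g = (\<lambda>s. u (z + s *\<^sub>R a + t *\<^sub>R b) - u (z + s *\<^sub>R a))"
    have dg: "(g has_real_derivative
        Da (z + s *\<^sub>R a + t *\<^sub>R b) - Da (z + s *\<^sub>R a)) (at s)" if "\<bar>s\<bar> < m" for s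
    proof -
      have *: "((\<lambda>s. u (z + s *\<^sub>R a + v)) has_real_derivative
              Da (z + s *\<^sub>R a + v)) (at s)" if "z + s *\<^sub>R a + v \<in> S" for v
      proof -
        have "((\<lambda>s. u (z + s *\<^sub>R a + v)) has_derivative
           (\<lambda>h. frechet_derivative u (at (z + s *\<^sub>R a + v)) (h *\<^sub>R a))) (at s)"
          by (rule has_derivative_compose[where f="\<lambda>s. z + s *\<^sub>R a + v" and g=u, OF _ C1_onD[OF u that]])
             (auto intro!: derivative_eq_intros)
        moreover have "linear (frechet_derivative u (at (z + s *\<^sub>R a + v)))"
          using C1_onD[OF u that] has_derivative_linear by blast
        ultimately show ?thesis
          by (simp add: has_field_derivative_def Da_def linear_cmul mult.commute[of _ "frechet_derivative _ _ _"])
      qed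
      show ?thesis
        unfolding g_def using *[of "t *\<^sub>R b"] *[of 0] inS[of s t] inS[of s 0] that t
        by (auto intro!: DERIV_diff)
    qed
    obtain \<xi> where \<xi>: "0 < \<xi>" "\<xi> < t"
      "g t - g 0 = (t - 0) * (Da (z + \<xi> *\<^sub>R a + t *\<^sub>R b) - Da (z + \<xi> *\<^sub>R a))"
      using MVT2[of 0 t g "\<lambda>s. Da (z + s *\<^sub>R a + t *\<^sub>R b) - Da (z + s *\<^sub>R a)"] dg t by auto
    have dDa: "((\<lambda>s. Da (z + \<xi> *\<^sub>R a + s *\<^sub>R b)) has_real_derivative
        Dab (z + \<xi> *\<^sub>R a + s *\<^sub>R b)) (at s)" if "\<bar>s\<bar> < m" for s
    proof -
      have i: "z + \<xi> *\<^sub>R a + s *\<^sub>R b \<in> S"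
        using inS[of \<xi> s] that \<xi> t by auto
      have "((\<lambda>s. Da (z + \<xi> *\<^sub>R a + s *\<^sub>R b)) has_derivative
         (\<lambda>h. frechet_derivative Da (at (z + \<xi> *\<^sub>R a + s *\<^sub>R b)) (h *\<^sub>R b))) (at s)"
        by (rule has_derivative_compose[where f="\<lambda>s. z + \<xi> *\<^sub>R a + s *\<^sub>R b" and g=Da, OF _ C1_onD[OF ua[folded Da_def] i]])
           (auto intro!: derivative_eq_intros)
      moreover have "linear (frechet_derivative Da (at (z + \<xi> *\<^sub>R a + s *\<^sub>R b)))"
        using C1_onD[OF ua[folded Da_def] i] has_derivative_linear by blast
      ultimately show ?thesis
        by (simp add: has_field_derivative_def Dab_def linear_cmul mult.commute[of _ "frechet_derivative _ _ _"])
    qed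
    obtain \<eta> where \<eta>: "0 < \<eta>" "\<eta> < t"
      "Da (z + \<xi> *\<^sub>R a + t *\<^sub>R b) - Da (z + \<xi> *\<^sub>R a + 0 *\<^sub>R b) = (t - 0) * Dab (z + \<xi> *\<^sub>R a + \<eta> *\<^sub>R b)"
      using MVT2[of 0 t "\<lambda>s. Da (z + \<xi> *\<^sub>R a + s *\<^sub>R b)" "\<lambda>s. Dab (z + \<xi> *\<^sub>R a + s *\<^sub>R b)"] dDa t
      by auto
    have "?\<Delta> t = g t - g 0"
      by (simp add: g_def)
    also have "\<dots> = t\<^sup>2 * Dab (z + \<xi> *\<^sub>R a + \<eta> *\<^sub>R b)"
      using \<xi>(3) \<eta>(3) by (simp add: power2_eq_square)
    finally have "?\<Delta> t / t\<^sup>2 = Dab (z + \<xi> *\<^sub>R a + \<eta> *\<^sub>R b)"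
      using t by simp
    moreover have "dist (Dab (z + \<xi> *\<^sub>R a + \<eta> *\<^sub>R b)) (Dab z) < e"
      using close[of \<xi> \<eta>] \<xi> \<eta> t d by auto
    ultimately show ?thesis
      by (simp add: Dab_def Da_def)
  qed
  then show "\<forall>\<^sub>F t in at_right 0. dist (?\<Delta> t / t\<^sup>2) ?L < e"
    using m by (auto simp: eventually_at_right_field)
qed

text \<open>The second difference is symmetric in \<open>a\<close> and \<open>b\<close>, so both
  mixed derivatives are limits of the same quotient.\<close>

lemma C2_on_mixed_partials:
  fixes u :: "'a::euclidean_space \<Rightarrow> real"
  assumes "open S" "z \<in> S" "C2_on S u"
  shows "frechet_derivative (\<lambda>w. frechet_derivative u (at w) a) (at z) b =
         frechet_derivative (\<lambda>w. frechet_derivative u (at w) b) (at z) a"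
proof (rule tendsto_unique)
  let ?\<Delta> = "\<lambda>t. (u (z + t *\<^sub>R a + t *\<^sub>R b) - u (z + t *\<^sub>R a) - u (z + t *\<^sub>R b) + u z) / t\<^sup>2"
  show "(?\<Delta> \<longlongrightarrow> frechet_derivative (\<lambda>w. frechet_derivative u (at w) a) (at z) b) (at_right 0)"
    using assms second_difference_tendsto unfolding C2_on_def by blast
  have "?\<Delta> = (\<lambda>t. (u (z + t *\<^sub>R b + t *\<^sub>R a) - u (z + t *\<^sub>R b) - u (z + t *\<^sub>R a) + u z) / t\<^sup>2)"
    by (simp add: algebra_simps)
  then show "(?\<Delta> \<longlongrightarrow> frechet_derivative (\<lambda>w. frechet_derivative u (at w) b) (at z) a) (at_right 0)"
    using assms second_difference_tendsto[of S z u b a] unfolding C2_on_def by simp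
qed simp

section \<open>Holomorphic completion via the Cauchy-Riemann equations\<close>

lemma frechet_derivative_complex:
  fixes f :: "complex \<Rightarrow> real"
  assumes "f differentiable (at z)"
  shows "frechet_derivative f (at z) v =
    Re v * frechet_derivative f (at z) 1 + Im v * frechet_derivative f (at z) \<i>"
proof -
  have l: "linear (frechet_derivative f (at z))"
    using assms by (simp add: linear_frechet_derivative)
  have "v = Re v *\<^sub>R 1 + Im v *\<^sub>R \<i>"
    by (simp add: complex_eq_iff)
  then have "frechet_derivative f (at z) v = frechet_derivative f (at z) (Re v *\<^sub>R 1 + Im v *\<^sub>R \<i>)"
    by metis
  also have "\<dots> = Re v * frechet_derivative f (at z) 1 + Im v * frechet_derivative f (at z) \<i>"
    using l by (simp only: linear_add linear_cmul real_scaleR_def)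
  finally show ?thesis .
qed

lemma laplacian_complex:
  fixes f :: "complex \<Rightarrow> real"
  shows "laplacian f z =
     frechet_derivative (\<lambda>w. frechet_derivative f (at w) 1) (at z) 1 +
     frechet_derivative (\<lambda>w. frechet_derivative f (at w) \<i>) (at z) \<i>"
  by (simp add: laplacian_def Basis_complex_def)

text \<open>If u = Re F, then F' must be u_x - i u_y. This function is holomorphic: one
  Cauchy-Riemann equation is Laplace's equation, the other is the symmetry of mixed derivatives. It
  has a primitive on a convex set, whose real part has the same gradient as
  \<open>u\<close>.\<close>

lemma harmonic_on_imp_Re_holomorphic:
  fixes u :: "complex \<Rightarrow> real"
  assumes S: "open S" "convex S" and u: "harmonic_on S u"
  obtains F where "F holomorphic_on S" "\<And>z. z \<in> S \<Longrightarrow> u z = Re (F z)"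
proof -
  define p q where "p = (\<lambda>z. frechet_derivative u (at z) 1)" and "q = (\<lambda>z. frechet_derivative u (at z) \<i>)"
  define f where "f = (\<lambda>z. Complex (p z) (- q z))"
  have C1: "C1_on S u" "C1_on S p" "C1_on S q"
    using u by (auto simp: harmonic_on_def C2_on_def p_def q_def)
  have f_deriv: "f field_differentiable at z" if z: "z \<in> S" for z
  proof -
    let ?p1 = "frechet_derivative p (at z) 1" and ?pi = "frechet_derivative p (at z) \<i>"
    have pd: "p differentiable at z" "q differentiable at z"
      using C1 z by (auto simp: C1_on_def)
    have qi: "frechet_derivative q (at z) \<i> = - ?p1"
      using u z by (simp add: harmonic_on_def laplacian_complex p_def q_def add_eq_0_iff2 add.commute)
    have q1: "frechet_derivative q (at z) 1 = ?pi"
      using C2_on_mixed_partials[of S z u \<i> 1] u z S by (simp add: harmonic_on_def p_def q_def)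
    have "(f has_derivative (\<lambda>h. of_real (frechet_derivative p (at z) h)
             - \<i> * of_real (frechet_derivative q (at z) h))) (at z)"
      unfolding f_def Complex_eq
      by (auto intro!: derivative_eq_intros C1_onD[OF C1(2) z] C1_onD[OF C1(3) z])
    also have "(\<lambda>h. of_real (frechet_derivative p (at z) h)
             - \<i> * of_real (frechet_derivative q (at z) h)) = (*) (Complex ?p1 (- ?pi))"
    proof
      fix h
      show "of_real (frechet_derivative p (at z) h) - \<i> * of_real (frechet_derivative q (at z) h)
         = Complex ?p1 (- ?pi) * h"
        using frechet_derivative_complex[OF pd(1), of h] frechet_derivative_complex[OF pd(2), of h] qi q1
        by (simp add: complex_eq_iff algebra_simps)
    qed
    finally show ?thesis
      by (auto simp: field_differentiable_def has_field_derivative_def)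
  qed
  then have "f holomorphic_on S"
    by (simp add: holomorphic_on_def field_differentiable_at_within)
  then obtain F where F: "\<And>z. z \<in> S \<Longrightarrow> (F has_field_derivative f z) (at z within S)"
    using holomorphic_convex_primitive'[OF S(2,1)] by blast
  have "((\<lambda>z. u z - Re (F z)) has_derivative (\<lambda>h. 0)) (at z within S)" if z: "z \<in> S" for z
  proof -
    have "((\<lambda>z. u z - Re (F z)) has_derivative
        (\<lambda>h. frechet_derivative u (at z) h - Re (f z * h))) (at z within S)"
      by (rule derivative_intros has_derivative_at_withinI[OF C1_onD[OF C1(1) z]]
          F[OF z, unfolded has_field_derivative_def])+
    also have "(\<lambda>h. frechet_derivative u (at z) h - Re (f z * h)) = (\<lambda>h. 0)"
    proof
      fix h
      have "u differentiable at z"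
        using C1(1) z by (simp add: C1_on_def)
      from frechet_derivative_complex[OF this, of h]
      show "frechet_derivative u (at z) h - Re (f z * h) = 0"
        by (simp add: f_def p_def q_def algebra_simps)
    qed
    finally show ?thesis .
  qed
  then have "\<exists>c. \<forall>z\<in>S. u z - Re (F z) = c"
    by (rule has_derivative_zero_constant[OF S(2)])
  then obtain c where c: "\<And>z. z \<in> S \<Longrightarrow> u z - Re (F z) = c"
    by blast
  show ?thesis
  proof
    show "(\<lambda>z. F z + of_real c) holomorphic_on S"
      using F by (intro holomorphic_intros) (auto simp: holomorphic_on_def field_differentiable_def)
    show "u z = Re (F z + of_real c)" if "z \<in> S" for z
      using c[OF that] by simp
  qed
qed

section \<open>Harmonicity of real parts of holomorphic functions\<close>

lemma Re_holomorphic_frechet: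
  assumes "f holomorphic_on S" "open S" "z \<in> S"
  shows "((\<lambda>z. Re (f z)) has_derivative (\<lambda>v. Re (deriv f z * v))) (at z)"
  using holomorphic_derivI[OF assms] unfolding has_field_derivative_def
  by (rule has_derivative_Re)

text \<open>Agreement of \<open>g\<close> with \<open>Re (f z)\<close> is assumed on
  \<open>S\<close> only, so that the lemma can be applied again to the derivatives of
  \<open>g\<close>, which are identified only there.\<close>

lemma Re_holomorphic_C1_on:
  assumes f: "f holomorphic_on S" "open S" and g: "\<And>z. z \<in> S \<Longrightarrow> g z = Re (f z)"
  shows "C1_on S g" "\<And>z v. z \<in> S \<Longrightarrow> frechet_derivative g (at z) v = Re (deriv f z * v)"
proof -
  have d: "(g has_derivative (\<lambda>v. Re (deriv f z * v))) (at z)" if "z \<in> S" for z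
    by (rule has_derivative_transform_within_open[OF Re_holomorphic_frechet[OF f that] f(2) that])
       (simp add: g)
  show fd: "frechet_derivative g (at z) v = Re (deriv f z * v)" if "z \<in> S" for z v
    using frechet_derivative_at[OF d[OF that]] by (metis)
  have "continuous_on S (\<lambda>z. Re (deriv f z * v))" for v
    by (intro continuous_intros holomorphic_on_imp_continuous_on holomorphic_deriv f)
  then show "C1_on S g"
    unfolding C1_on_def using d fd by (auto simp: differentiable_def cong: continuous_on_cong)
qed

text \<open>The second derivative in direction v is Re (f'' v^2), and the directions
  \<open>1\<close> and \<open>\<i>\<close> give opposite values.\<close>

lemma Re_holomorphic_harmonic_on:
  assumes f: "f holomorphic_on S" "open S" and u: "\<And>z. z \<in> S \<Longrightarrow> u z = Re (f z)"
  shows "harmonic_on S u"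
proof -
  have hol: "(\<lambda>z. deriv f z * v) holomorphic_on S" for v
    by (intro holomorphic_intros holomorphic_deriv f)
  have eq: "frechet_derivative u (at z) v = Re (deriv f z * v)" if "z \<in> S" for z v
    by (rule Re_holomorphic_C1_on(2)[OF f u that])
  have dd: "deriv (\<lambda>w. deriv f w * v) z = deriv (deriv f) z * v" if "z \<in> S" for z v
    using holomorphic_derivI[OF holomorphic_deriv[OF f] f(2) that]
    by (intro DERIV_imp_deriv DERIV_cmult_right)
  have "laplacian u z = 0" if "z \<in> S" for z
    unfolding laplacian_complex
    using Re_holomorphic_C1_on(2)[OF hol f(2) eq that, of 1 1]
      Re_holomorphic_C1_on(2)[OF hol f(2) eq that, of \<i> \<i>] dd that
    by simp
  moreover have "C1_on S u" "C1_on S (\<lambda>z. frechet_derivative u (at z) v)" for v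
    using Re_holomorphic_C1_on(1)[OF f u] Re_holomorphic_C1_on(1)[OF hol f(2) eq] by auto
  ultimately show ?thesis
    by (simp add: harmonic_on_def C2_on_def)
qed

subsection \<open>The Poisson integral\<close>

text \<open>Formally, with v(s) the integral of \<open>g\<close> over the arc of half-length s,
  integration by parts gives v(h) k(c + h) - int_0^h v(s) k'(c + s) ds. Since -k' and k(c + h) are
  nonnegative, replacing v by \<open>N\<close> can only increase this, and the result telescopes to
  N k(c). The proof casts this as monotonicity of an auxiliary function.\<close>

lemma symmetric_kernel_bound:
  fixes g k :: "real \<Rightarrow> real"
  assumes h: "0 \<le> h"
    and g: "continuous_on UNIV g"
    and k: "\<And>t. (k has_real_derivative k' t) (at t)"
    and k_sym: "\<And>s. k (c - s) = k (c + s)"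
    and k_dec: "\<And>s. \<lbrakk>0 \<le> s; s \<le> h\<rbrakk> \<Longrightarrow> k' (c + s) \<le> 0"
    and k_nonneg: "0 \<le> k (c + h)"
    and N: "\<And>s. \<lbrakk>0 \<le> s; s \<le> h\<rbrakk> \<Longrightarrow> integral {c - s..c + s} g \<le> N"
  shows "integral {c - h..c + h} (\<lambda>t. g t * k t) \<le> N * k c"
proof -
  have k_cont: "continuous_on UNIV k"
    using k by (meson DERIV_isCont continuous_at_imp_continuous_on)
  have sym_deriv: "((\<lambda>s. integral {c - s..c + s} f) has_real_derivative f (c + s) + f (c - s)) (at s)"
    if f: "continuous_on UNIV f" and s: "0 < s" "s < h + 1" for f :: "real \<Rightarrow> real" and s
  proof -
    \<comment> \<open>Starting one unit outside the arc makes the derivative two-sided even at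
      \<open>s = h\<close>.\<close>
    let ?F = "\<lambda>x. integral {c - (h + 1)..x} f"
    have int: "f integrable_on {a..b}" for a b
      using f continuous_on_subset integrable_continuous_real by blast
    have F: "(?F has_real_derivative f x) (at x)" if "c - (h + 1) < x" "x < c + (h + 1)" for x
    proof -
      have "(?F has_real_derivative f x) (at x within {c - (h + 1)..c + (h + 1)})"
        using f that by (intro integral_has_real_derivative continuous_on_subset[OF f]) auto
      then show ?thesis
        using at_within_interior[of x "{c - (h + 1)..c + (h + 1)}"] that by simp
    qed
    have "((\<lambda>s. ?F (c + s) - ?F (c - s)) has_real_derivative f (c + s) + f (c - s)) (at s)"
      using s by (auto intro!: derivative_eq_intros DERIV_chain2[OF F])
    moreover have eq: "?F (c + t) - ?F (c - t) = integral {c - t..c + t} f" if "t \<in> {0<..<h + 1}" for t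
      using Henstock_Kurzweil_Integration.integral_combine[of "c - (h + 1)" "c - t" "c + t" f] int that
      by simp
    ultimately show ?thesis
      using s
      by (elim has_field_derivative_transform_within_open[where S = "{0<..<h + 1}"]) (auto simp: eq)
  qed
  define v where "v = (\<lambda>s. integral {c - s..c + s} g)"
  define \<Phi> where "\<Phi> = (\<lambda>s. integral {c - s..c + s} (\<lambda>t. g t * k t))"
  \<comment> \<open>Since \<open>\<Phi>'(s) = v'(s) * k (c + s)\<close>, only the derivative of \<open>k\<close> survives in \<open>\<Psi>'\<close>.\<close>
  define \<Psi> where "\<Psi> = (\<lambda>s. \<Phi> s + (N - v s) * k (c + s))"
  have gk: "continuous_on UNIV (\<lambda>t. g t * k t)"
    by (intro continuous_intros g k_cont)
  have \<Psi>': "(\<Psi> has_real_derivative (N - v s) * k' (c + s)) (at s)" if "0 < s" "s < h + 1" for s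
  proof -
    have "(\<Psi> has_real_derivative (g (c + s) * k (c + s) + g (c - s) * k (c - s)) +
       ((0 - (g (c + s) + g (c - s))) * k (c + s) + k' (c + s) * 1 * (N - v s))) (at s)"
      unfolding \<Psi>_def \<Phi>_def v_def
      by (intro DERIV_add DERIV_mult DERIV_diff DERIV_const sym_deriv g gk that DERIV_chain2[OF k])
         (auto intro!: derivative_eq_intros)
    then show ?thesis
      by (simp add: k_sym algebra_simps)
  qed
  have cont0: "((\<lambda>s. integral {c - s..c + s} f) \<longlongrightarrow> 0) (at_right 0)"
    if f: "continuous_on UNIV f" for f :: "real \<Rightarrow> real"
  proof -
    have int: "f integrable_on {a..b}" for a b
      using f continuous_on_subset integrable_continuous_real by blast
    have "continuous_on {c - 1..c + 1} (\<lambda>x. integral {c - 1..x} f)"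
      by (intro indefinite_integral_continuous_1 int)
    then have "isCont (\<lambda>x. integral {c - 1..x} f) c"
      by (rule continuous_on_interior) simp
    then have F: "((\<lambda>x. integral {c - 1..x} f) \<longlongrightarrow> integral {c - 1..c} f) (nhds c)"
      using tendsto_at_iff_tendsto_nhds[of "\<lambda>x. integral {c - 1..x} f" c]
      by (simp add: isCont_def)
    have "((\<lambda>s. integral {c - 1..c + s} f - integral {c - 1..c - s} f) \<longlongrightarrow>
       integral {c - 1..c} f - integral {c - 1..c} f) (at_right 0)"
      by (intro tendsto_diff filterlim_compose[OF F]) (auto intro!: tendsto_eq_intros)
    moreover have "\<forall>\<^sub>F s in at_right 0. integral {c - 1..c + s} f - integral {c - 1..c - s} f
       = integral {c - s..c + s} f"
      unfolding eventually_at_right_field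
    proof (intro exI[of _ 1] conjI allI impI)
      fix s :: real assume "0 < s" "s < 1"
      then show "integral {c - 1..c + s} f - integral {c - 1..c - s} f = integral {c - s..c + s} f"
        using Henstock_Kurzweil_Integration.integral_combine[of "c - 1" "c - s" "c + s" f] int by simp
    qed simp
    ultimately show ?thesis
      by (simp add: tendsto_cong)
  qed
  have "((\<lambda>s. k (c + s)) \<longlongrightarrow> k (c + 0)) (at_right 0)"
    using k[of c] by (intro tendsto_intros isCont_tendsto_compose[where g = k]) (auto dest: DERIV_isCont)
  \<comment> \<open>Both integrals vanish as the arc shrinks. A limit replaces evaluation at
    \<open>0\<close> because the derivative of \<open>\<Psi>\<close> is established only for
    positive \<open>s\<close>.\<close>
  then have lim: "(\<Psi> \<longlongrightarrow> N * k c) (at_right 0)"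
    unfolding \<Psi>_def \<Phi>_def v_def
    by (auto intro!: tendsto_eq_intros cont0 g gk)
  have "\<Psi> h \<le> N * k c"
  proof (cases "h = 0")
    case True
    then show ?thesis by (simp add: \<Psi>_def \<Phi>_def v_def)
  next
    case False
    have "\<Psi> h \<le> \<Psi> s" if "0 < s" "s \<le> h" for s
    proof (rule DERIV_nonpos_imp_nonincreasing[OF that(2)])
      fix x assume x: "s \<le> x" "x \<le> h"
      then have "(N - v x) * k' (c + x) \<le> 0"
        using that N[of x] k_dec[of x] by (intro mult_nonneg_nonpos) (auto simp: v_def)
      then show "\<exists>y. (\<Psi> has_real_derivative y) (at x) \<and> y \<le> 0"
        using \<Psi>'[of x] that x by auto
    qed
    then have "\<forall>\<^sub>F s in at_right 0. \<Psi> h \<le> \<Psi> s"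
      unfolding eventually_at_right_field using h False by (intro exI[of _ h]) auto
    then show ?thesis
      by (rule tendsto_lowerbound[OF lim]) simp
  qed
  moreover have "0 \<le> (N - v h) * k (c + h)"
    using N[of h] h k_nonneg by (simp add: v_def)
  ultimately show ?thesis
    by (simp add: \<Psi>_def \<Phi>_def)
qed

text \<open>Cauchy's formula for F(r) has kernel w / (w - r) on the circle. Adding r w / (R^2 - r
  w), which contributes nothing because it has no pole in the closed disc, makes the kernel real.
  Negative \<open>r\<close> is allowed.\<close>

lemma Poisson_integral:
  fixes F :: "complex \<Rightarrow> complex"
  assumes F: "F holomorphic_on ball 0 1" and r: "\<bar>r\<bar> < R" "R < 1"
  shows "((\<lambda>t. F (R * cis t) * of_real ((R\<^sup>2 - r\<^sup>2) / (R\<^sup>2 - 2 * R * r * cos t + r\<^sup>2)))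
           has_integral 2 * pi * F r) {0..2 * pi}"
proof -
  have "cball (0::complex) R \<subseteq> ball 0 1"
    using r by auto
  then have F': "F holomorphic_on cball 0 R"
    using F holomorphic_on_subset by blast
  have ne: "of_real (R\<^sup>2) - of_real r * w \<noteq> 0" if "w \<in> cball 0 R" for w :: complex
  proof
    assume *: "of_real (R\<^sup>2) - of_real r * w = (0::complex)"
    then have "R\<^sup>2 = norm (of_real r * w)"
      by (metis eq_iff_diff_eq_0 norm_of_real abs_power2)
    also have "\<dots> \<le> \<bar>r\<bar> * R"
      using that by (simp add: norm_mult mult_left_mono)
    also have "\<dots> < R * R"
      using r by (intro mult_strict_right_mono) auto
    finally show False by (simp add: power2_eq_square)
  qed
  have 1: "((\<lambda>u. F u / (u - of_real r)) has_contour_integral (2 * of_real pi * \<i> * F r)) (circlepath 0 R)"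
    using r by (intro Cauchy_integral_circlepath_simple F') auto
  have "(\<lambda>u. F u * of_real r / (of_real (R\<^sup>2) - of_real r * u)) holomorphic_on cball 0 R"
    using ne by (intro holomorphic_intros F') auto
  then have 2: "((\<lambda>u. F u * of_real r / (of_real (R\<^sup>2) - of_real r * u)) has_contour_integral 0) (circlepath 0 R)"
    using r by (intro Cauchy_theorem_convex_simple[where S = "cball 0 R"]) auto
  have "((\<lambda>u. F u / (u - of_real r) + F u * of_real r / (of_real (R\<^sup>2) - of_real r * u))
      has_contour_integral (2 * of_real pi * \<i> * F r)) (part_circlepath 0 R 0 (2 * pi))"
    using has_contour_integral_add[OF 1 2] by (simp add: circlepath_def)
  then have "((\<lambda>t. (F (R * cis t) / (R * cis t - of_real r) +
       F (R * cis t) * of_real r / (of_real (R\<^sup>2) - of_real r * (R * cis t))) * R * \<i> * cis t)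
       has_integral 2 * of_real pi * \<i> * F r) {0..2 * pi}"
    by (simp add: has_contour_integral_part_circlepath_iff)
  \<comment> \<open>The factor \<open>- \<i>\<close> cancels the \<open>\<i>\<close> coming from dw
    = i w dt.\<close>
  then have *: "((\<lambda>t. - \<i> * ((F (R * cis t) / (R * cis t - of_real r) +
       F (R * cis t) * of_real r / (of_real (R\<^sup>2) - of_real r * (R * cis t))) * R * \<i> * cis t))
       has_integral - \<i> * (2 * of_real pi * \<i> * F r)) {0..2 * pi}"
    by (rule has_integral_mult_right)
  have kernel: "w / (w - of_real r) + of_real r * w / (of_real (R\<^sup>2) - of_real r * w)
        = of_real ((R\<^sup>2 - r\<^sup>2) / (R\<^sup>2 - 2 * R * r * cos t + r\<^sup>2))" if w: "w = R * cis t" for w t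
  proof -
    have nw: "norm w = R" using r by (simp add: w norm_mult)
    have ww: "w * cnj w = of_real (R\<^sup>2)"
      using nw by (simp add: complex_norm_square[symmetric])
    have n1: "w - of_real r \<noteq> 0"
      using nw r by auto
    have nw0: "w \<noteq> 0" using nw r by auto
    have n2: "cnj w - of_real r \<noteq> 0"
      using n1 by (metis complex_cnj_cnj complex_cnj_complex_of_real right_minus_eq)
    have d: "(w - of_real r) * (cnj w - of_real r) = of_real (R\<^sup>2 - 2 * R * r * cos t + r\<^sup>2)"
      using ww by (simp add: algebra_simps w complex_eq_iff power2_eq_square)
    \<comment> \<open>On the circle R^2 is \<open>w * cnj w\<close>; hence a factor \<open>w\<close>
      cancels and the two denominators become complex conjugates.\<close>
    have "of_real (R\<^sup>2) - of_real r * w = w * (cnj w - of_real r)"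
      using ww by (simp add: algebra_simps)
    then have "of_real r * w / (of_real (R\<^sup>2) - of_real r * w) = of_real r / (cnj w - of_real r)"
      using nw0 by simp
    then have "w / (w - of_real r) + of_real r * w / (of_real (R\<^sup>2) - of_real r * w)
        = (w * (cnj w - of_real r) + of_real r * (w - of_real r)) / ((w - of_real r) * (cnj w - of_real r))"
      using n1 n2 by (simp add: add_frac_eq)
    also have "w * (cnj w - of_real r) + of_real r * (w - of_real r) = of_real (R\<^sup>2 - r\<^sup>2)"
      using ww by (simp add: algebra_simps power2_eq_square)
    finally show ?thesis
      unfolding d by simp
  qed
  have eq: "- \<i> * ((F (R * cis t) / (R * cis t - of_real r) +
       F (R * cis t) * of_real r / (of_real (R\<^sup>2) - of_real r * (R * cis t))) * R * \<i> * cis t)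
     = F (R * cis t) * of_real ((R\<^sup>2 - r\<^sup>2) / (R\<^sup>2 - 2 * R * r * cos t + r\<^sup>2))" for t
    unfolding kernel[OF refl, symmetric] by (simp add: algebra_simps add_divide_distrib)
  have "- \<i> * (2 * of_real pi * \<i> * F r) = 2 * pi * F r"
    by (simp add: complex_eq_iff)
  with * show ?thesis
    unfolding eq by metis
qed

subsection \<open>Norm inequalities and trigonometric integrals\<close>

lemma emeasure_lebesgue_on_pi: "emeasure (lebesgue_on {-pi..pi}) {-pi..pi} = ennreal (2 * pi)"
  by (simp add: emeasure_restrict_space)

lemma nn_integral_lebesgue_on_continuous:
  fixes f :: "real \<Rightarrow> real"
  assumes "continuous_on {a..b} f" "\<And>x. 0 \<le> f x"
  shows "(\<integral>\<^sup>+x. ennreal (f x) \<partial>lebesgue_on {a..b}) = ennreal (integral {a..b} f)"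
proof -
  have int: "integrable (lebesgue_on {a..b}) f"
    by (rule continuous_imp_integrable_real[OF assms(1)])
  then show ?thesis
    using assms(2) by (simp add: nn_integral_eq_integral lebesgue_integral_eq_integral)
qed

lemma enn2real_ge_1: "1 \<le> enn2real p" if "1 \<le> p" "p \<noteq> \<infinity>" for p :: ennreal
  using that by (cases p) (auto simp: ennreal_le_iff2 ennreal_ge_1)

text \<open>The interval has measure 2 pi, so the constant \<open>M\<close> has p-norm (2 pi)^(1/p)
  M.\<close>

lemma Lp_norm_le:
  assumes p: "1 \<le> p" and g: "g \<in> borel_measurable (lebesgue_on {-pi..pi})"
    and M: "\<And>\<theta>. \<bar>g \<theta>\<bar> \<le> M"
  shows "Lp_norm p g \<le> ennreal (two_pi_root p * M)"
proof (cases "p = \<infinity>")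
  case True
  have "esssup (lebesgue_on {-pi..pi}) (\<lambda>\<theta>. ennreal \<bar>g \<theta>\<bar>) \<le> ennreal M"
    using M g by (intro esssup_I) (auto intro!: ennreal_leI)
  then show ?thesis
    using True by (simp add: Lp_norm_def two_pi_root_def)
next
  case False
  define q where "q = enn2real p"
  have q: "q \<ge> 1" using enn2real_ge_1[OF p False] by (simp add: q_def)
  have M0: "M \<ge> 0" using M[of 0] by linarith
  define J where "J = (\<integral>\<^sup>+\<theta>. ennreal (\<bar>g \<theta>\<bar> powr q) \<partial>lebesgue_on {-pi..pi})"
  have "J \<le> (\<integral>\<^sup>+\<theta>. ennreal (M powr q) \<partial>lebesgue_on {-pi..pi})"
    unfolding J_def using M q by (intro nn_integral_mono ennreal_leI powr_mono2) auto
  also have "\<dots> = ennreal (M powr q * (2 * pi))"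
    by (simp add: emeasure_lebesgue_on_pi ennreal_mult')
  finally have J: "J \<le> ennreal (M powr q * (2 * pi))" .
  then have "J \<noteq> \<infinity>"
    by (auto simp: top_unique)
  moreover have "enn2real J powr (1 / q) \<le> (M powr q * (2 * pi)) powr (1 / q)"
    using J q by (intro powr_mono2) (auto intro!: enn2real_leI)
  moreover have "(M powr q * (2 * pi)) powr (1 / q) = (2 * pi) powr (1 / q) * M"
    using q M0 by (simp add: powr_mult powr_powr)
  ultimately show ?thesis
    using False unfolding Lp_norm_def two_pi_root_def q_def[symmetric] J_def[symmetric] Let_def
    by (simp add: ennreal_leI)
qed

text \<open>A comparison of the 1-norm with the p-norm that is uniform in \<open>p\<close>: the
  constant \<open>4 * pi\<close> covers both 2 pi, for the essential supremum, and 1 + 2 pi, for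
  finite exponents.\<close>

lemma integral_abs_le_Lp_norm:
  assumes p: "1 \<le> p" and g: "continuous_on {-pi..pi} g" and l: "0 < l" "Lp_norm p g \<le> ennreal l"
  shows "integral {-pi..pi} (\<lambda>\<theta>. \<bar>g \<theta>\<bar>) \<le> 4 * pi * l"
proof -
  let ?L = "lebesgue_on {-pi..pi}"
  have [measurable]: "g \<in> borel_measurable ?L"
    using g by (intro continuous_imp_measurable_on_sets_lebesgue) auto
  have "(\<integral>\<^sup>+\<theta>. ennreal \<bar>g \<theta>\<bar> \<partial>?L) \<le> ennreal (4 * pi * l)"
  proof (cases "p = \<infinity>")
    case True
    have "AE \<theta> in ?L. ennreal \<bar>g \<theta>\<bar> \<le> ennreal l"
      using esssup_AE[where M = ?L and f = "\<lambda>\<theta>. ennreal \<bar>g \<theta>\<bar>"] l(2) True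
      by (auto simp: Lp_norm_def elim: eventually_mono)
    then have "(\<integral>\<^sup>+\<theta>. ennreal \<bar>g \<theta>\<bar> \<partial>?L) \<le> (\<integral>\<^sup>+\<theta>. ennreal l \<partial>?L)"
      by (rule nn_integral_mono_AE)
    also have "\<dots> = ennreal (l * (2 * pi))"
      using l by (simp add: emeasure_lebesgue_on_pi ennreal_mult')
    also have "\<dots> \<le> ennreal (4 * pi * l)"
      using l by (intro ennreal_leI) simp
    finally show ?thesis .
  next
    case False
    define q where "q = enn2real p"
    have q: "q \<ge> 1" using enn2real_ge_1[OF p False] by (simp add: q_def)
    define J where "J = (\<integral>\<^sup>+\<theta>. ennreal (\<bar>g \<theta>\<bar> powr q) \<partial>?L)"
    have Lp: "(if J = \<infinity> then \<infinity> else ennreal (enn2real J powr (1 / q))) \<le> ennreal l"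
      using l(2) unfolding Lp_norm_def J_def q_def Let_def by (simp only: False if_False)
    then have fin: "J \<noteq> \<infinity>"
      by (auto simp: top_unique)
    then have "enn2real J powr (1 / q) \<le> l"
      using Lp l by simp
    then have "(enn2real J powr (1 / q)) powr q \<le> l powr q"
      using q by (intro powr_mono2) auto
    then have "enn2real J \<le> l powr q"
      using q by (simp add: powr_powr)
    then have J: "J \<le> ennreal (l powr q)"
      using fin by (metis ennreal_enn2real ennreal_leI infinity_ennreal_def less_top)
    \<comment> \<open>This pointwise inequality does the work of Hoelder's: the summand
      \<open>l\<close> covers \<open>x \<le> l\<close>, and beyond that (x / l)^q is at least x /
      l.\<close>
    have "x \<le> l powr (1 - q) * x powr q + l" if "x \<ge> 0" for x
    proof (cases "x \<le> l")
      case False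
      have "l powr (1 - q) * x powr q = l * (x / l) powr q"
        using l that by (simp add: powr_diff powr_divide)
      also have "\<dots> \<ge> l * (x / l) powr 1"
        using q False l by (intro mult_left_mono powr_mono) auto
      finally show ?thesis
        using l that by simp
    qed (use that in \<open>auto intro: add_increasing\<close>)
    then have "(\<integral>\<^sup>+\<theta>. ennreal \<bar>g \<theta>\<bar> \<partial>?L)
      \<le> (\<integral>\<^sup>+\<theta>. ennreal (l powr (1 - q)) * ennreal (\<bar>g \<theta>\<bar> powr q) + ennreal l \<partial>?L)"
      using l by (intro nn_integral_mono) (simp flip: ennreal_mult ennreal_plus)
    also have "\<dots> = ennreal (l powr (1 - q)) * J + ennreal (l * (2 * pi))"
      unfolding J_def using l
      by (subst nn_integral_add) (auto simp: nn_integral_cmult emeasure_lebesgue_on_pi ennreal_mult')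
    also have "\<dots> \<le> ennreal (l powr (1 - q)) * ennreal (l powr q) + ennreal (l * (2 * pi))"
      using J by (intro add_mono mult_left_mono) auto
    also have "\<dots> = ennreal (l + l * (2 * pi))"
      using l by (simp flip: ennreal_mult ennreal_plus powr_add)
    also have "\<dots> \<le> ennreal (4 * pi * l)"
      using l pi_gt3 by (intro ennreal_leI) (simp add: algebra_simps)
    finally show ?thesis .
  qed
  moreover have "(\<integral>\<^sup>+\<theta>. ennreal \<bar>g \<theta>\<bar> \<partial>?L) = ennreal (integral {-pi..pi} (\<lambda>\<theta>. \<bar>g \<theta>\<bar>))"
    using g by (intro nn_integral_lebesgue_on_continuous continuous_intros) auto
  ultimately show ?thesis
    using l by (simp add: ennreal_le_iff)
qed

text \<open>The finite length forces \<open>I\<close> to be bounded; up to its endpoints it is then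
  some \<open>{a..b}\<close>, and the integral is \<open>G b - G a\<close>.\<close>

lemma abs_integral_interval_le:
  fixes G :: "real \<Rightarrow> real"
  assumes I: "is_interval I" "emeasure lborel I \<le> ennreal L"
    and G: "\<And>t. (G has_real_derivative f t) (at t)" and C: "\<And>t. \<bar>G t\<bar> \<le> C"
  shows "\<bar>integral I f\<bar> \<le> 2 * C"
proof (cases "I = {}")
  case True
  then show ?thesis using C[of 0] by simp
next
  case False
  \<comment> \<open>The absolute value makes the bound hold for negative \<open>L\<close> too, where
    \<open>ennreal L\<close> is \<open>0\<close>.\<close>
  have diam: "b - a \<le> \<bar>L\<bar>" if "a \<in> I" "b \<in> I" for a b
  proof (cases "a \<le> b")
    case True
    have "{a..b} \<subseteq> I"
      using mem_is_interval_1_I[OF I(1) that] by auto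
    then have "emeasure lborel {a..b} \<le> emeasure lborel I"
      using I(1) by (intro emeasure_mono) (auto simp: real_interval_borel_measurable)
    then have "ennreal (b - a) \<le> ennreal L"
      using I(2) True by simp
    then show ?thesis
      using True by (cases "0 \<le> L") (auto simp: ennreal_neg)
  qed simp
  have "\<exists>a b. a \<le> b \<and> (I = {a<..<b} \<or> I = {a<..b} \<or> I = {a..<b} \<or> I = {a..b})"
  proof -
    obtain x where x: "x \<in> I" using False by blast
    have out: "y \<notin> I" if "\<bar>L\<bar> < \<bar>y - x\<bar>" for y
      using diam[OF x, of y] diam[OF _ x, of y] that by auto
    have "I \<noteq> UNIV" "I \<noteq> {..<b}" "I \<noteq> {..b}" "I \<noteq> {a<..}" "I \<noteq> {a..}" for a b
      using out[of "x + \<bar>L\<bar> + 1"] out[of "x - \<bar>L\<bar> - 1"] x by auto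
    then obtain a b where ab: "I = {a<..<b} \<or> I = {a<..b} \<or> I = {a..<b} \<or> I = {a..b}"
      using is_real_interval[OF I(1)] False by (elim exE) blast
    then have "a \<le> b"
      using False by auto
    with ab show ?thesis by blast
  qed
  then obtain a b where ab: "a \<le> b" "I = {a<..<b} \<or> I = {a<..b} \<or> I = {a..<b} \<or> I = {a..b}"
    by blast
  have "integral I f = integral {a..b} f"
    by (rule integral_spike_set; rule negligible_subset[of "{a, b}"]; use ab in force)
  also have "\<dots> = G b - G a"
    using ab(1) G by (intro integral_unique fundamental_theorem_of_calculus)
      (auto simp: has_real_derivative_iff_has_vector_derivative[symmetric] intro: has_field_derivative_at_within)
  finally show ?thesis
    using C[of a] C[of b] by linarith
qed

section \<open>Orthogonality of cosines and Fourier coefficients\<close>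

lemma integral_cos_int:
  fixes j :: int
  shows "integral {-pi..pi} (\<lambda>t. cos (of_int j * t)) = (if j = 0 then 2 * pi else 0)"
proof (cases "j = 0")
  case False
  have "((\<lambda>t. cos (of_int j * t)) has_integral sin (of_int j * pi) / of_int j - sin (of_int j * (-pi)) / of_int j) {-pi..pi}"
    using False by (intro fundamental_theorem_of_calculus)
      (auto simp: has_real_derivative_iff_has_vector_derivative[symmetric] intro!: derivative_eq_intros)
  then have "integral {-pi..pi} (\<lambda>t. cos (of_int j * t)) = 0"
    by (simp add: integral_unique sin_zero_iff_int2 mult.commute)
  then show ?thesis using False by simp
qed simp

lemma integral_cos_cos:
  fixes j k :: nat
  assumes "0 < k"
  shows "integral {-pi..pi} (\<lambda>t. cos (real j * t) * cos (real k * t)) = (if j = k then pi else 0)"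
proof -
  have "cos (real j * t) * cos (real k * t)
       = (cos (of_int (int j - int k) * t) + cos (of_int (int j + int k) * t)) / 2" for t
    by (simp add: cos_times_cos algebra_simps)
  moreover have "(\<lambda>t. cos (of_int i * t)) integrable_on {-pi..pi}" for i :: int
    by (intro integrable_continuous_real continuous_intros)
  moreover have "int j + int k \<noteq> 0" using assms by simp
  ultimately show ?thesis
    by (simp only: integral_divide Henstock_Kurzweil_Integration.integral_add integral_cos_int) auto
qed

text \<open>Absolute summability gives uniform convergence, so the product with the
  \<open>m\<close>-th cosine may be integrated termwise. By orthogonality and injectivity of
  \<open>n\<close> only the term \<open>k = m\<close> survives.\<close>

lemma cos_series_coefficient:
  fixes c :: "nat \<Rightarrow> real"
  assumes n: "inj n" "0 < n m"
    and c: "summable (\<lambda>k. \<bar>c k\<bar>)" and U: "\<And>t. (\<lambda>k. c k * cos (real (n k) * t)) sums U t"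
  shows "continuous_on UNIV U"
    and "integral {-pi..pi} (\<lambda>t. U t * cos (real (n m) * t)) = pi * c m"
proof -
  have unif: "uniform_limit UNIV (\<lambda>K t. \<Sum>k<K. c k * cos (real (n k) * t))
        (\<lambda>t. \<Sum>k. c k * cos (real (n k) * t)) sequentially"
    by (rule Weierstrass_m_test[OF _ c]) (simp add: abs_mult mult_left_le)
  also have "(\<lambda>t. \<Sum>k. c k * cos (real (n k) * t)) = U"
    using sums_unique[OF U] by (simp add: fun_eq_iff)
  finally have unif: "uniform_limit UNIV (\<lambda>K t. \<Sum>k<K. c k * cos (real (n k) * t)) U sequentially" .
  show contU: "continuous_on UNIV U"
    by (rule uniform_limit_theorem[OF _ unif]) (auto intro!: always_eventually continuous_intros)
  have "uniform_limit {-pi..pi} (\<lambda>K t. \<Sum>k<K. c k * cos (real (n k) * t)) U sequentially"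
    using unif uniform_limit_on_subset by blast
  then have "uniform_limit {-pi..pi} (\<lambda>K t. (\<Sum>k<K. c k * cos (real (n k) * t)) * cos (real (n m) * t))
      (\<lambda>t. U t * cos (real (n m) * t)) sequentially"
  proof (rule uniform_lim_mult[OF _ uniform_limit_const])
    show "bounded (U ` {-pi..pi})"
      using contU by (intro compact_imp_bounded compact_continuous_image) (auto intro: continuous_on_subset)
    show "bounded ((\<lambda>t. cos (real (n m) * t)) ` {-pi..pi})"
      by (intro compact_imp_bounded compact_continuous_image continuous_intros) auto
  qed
  then obtain I J where IJ: "\<And>K. ((\<lambda>t. (\<Sum>k<K. c k * cos (real (n k) * t)) * cos (real (n m) * t)) has_integral I K) {-pi..pi}"
      "((\<lambda>t. U t * cos (real (n m) * t)) has_integral J) {-pi..pi}" "I \<longlonglongrightarrow> J"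
    by (rule uniform_limit_integral) (auto intro!: continuous_intros)
  have "I K = pi * c m" if "m < K" for K
  proof -
    have "I K = integral {-pi..pi} (\<lambda>t. \<Sum>k<K. c k * (cos (real (n k) * t) * cos (real (n m) * t)))"
      using integral_unique[OF IJ(1)[of K]] by (simp add: sum_distrib_right mult.assoc)
    also have "\<dots> = (\<Sum>k<K. integral {-pi..pi} (\<lambda>t. c k * (cos (real (n k) * t) * cos (real (n m) * t))))"
      by (intro Henstock_Kurzweil_Integration.integral_sum integrable_continuous_real continuous_intros) auto
    also have "\<dots> = (\<Sum>k<K. if k = m then pi * c m else 0)"
      using n by (intro sum.cong) (auto simp: integral_cos_cos inj_eq)
    finally show ?thesis using that by simp
  qed
  then have "\<forall>\<^sub>F K in sequentially. I K = pi * c m"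
    using eventually_gt_at_top by (rule eventually_mono[rotated])
  then have "J = pi * c m"
    using IJ(3) tendsto_eventually LIMSEQ_unique by blast
  then show "integral {-pi..pi} (\<lambda>t. U t * cos (real (n m) * t)) = pi * c m"
    using IJ(2) by (simp add: integral_unique)
qed

subsection \<open>The growth estimate\<close>

lemma continuous_on_holomorphic_slice:
  assumes "F holomorphic_on ball 0 1" "0 \<le> R" "R < 1"
  shows "continuous_on UNIV (\<lambda>t. F (complex_of_real R * cis (t + a)))"
proof (rule continuous_on_compose2[OF holomorphic_on_imp_continuous_on[OF assms(1)]])
  show "continuous_on UNIV (\<lambda>t. complex_of_real R * cis (t + a))"
    by (intro continuous_intros)
qed (use assms in \<open>auto simp: norm_mult\<close>)

text \<open>The circle is rotated so that the Poisson kernel of \<open>- r\<close> is symmetric about \<open>pi\<close>,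
  the midpoint of the integration interval.\<close>

lemma Re_holomorphic_circle_bound:
  assumes F: "F holomorphic_on ball 0 1" and r: "0 \<le> r" "r < R" "R < 1"
    and N: "\<And>a s. \<lbrakk>0 \<le> s; s \<le> pi\<rbrakk> \<Longrightarrow>
      integral {a - s..a + s} (\<lambda>t. Re (F (complex_of_real R * cis t))) \<le> N"
  shows "Re (F (complex_of_real r * cis \<theta>)) \<le> N * ((R + r) / (R - r)) / (2 * pi)"
proof -
  \<comment> \<open>Since \<open>cis (\<theta> - pi) = - cis \<theta>\<close>, the value of
    \<open>G\<close> at \<open>- r\<close> is the value of \<open>F\<close> at the point in
    question.\<close>
  define G where "G = (\<lambda>w. F (w * cis (\<theta> - pi)))"
  have "(\<lambda>w. w * cis (\<theta> - pi)) ` ball 0 1 \<subseteq> ball 0 1"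
    by (auto simp: norm_mult)
  then have G: "G holomorphic_on ball 0 1"
    unfolding G_def
    by (intro holomorphic_on_compose_gen[OF _ F, unfolded o_def] holomorphic_intros)
  define k where "k = (\<lambda>t. (R\<^sup>2 - r\<^sup>2) / (R\<^sup>2 + 2 * R * r * cos t + r\<^sup>2))"
  define k' where "k' = (\<lambda>t. (R\<^sup>2 - r\<^sup>2) * (2 * R * r * sin t) / (R\<^sup>2 + 2 * R * r * cos t + r\<^sup>2)\<^sup>2)"
  define g where "g = (\<lambda>t. Re (F (complex_of_real R * cis (t + (\<theta> - pi)))))"
  have den: "R\<^sup>2 + 2 * R * r * cos t + r\<^sup>2 > 0" for t
  proof -
    have "R * r * cos t \<ge> R * r * (- 1)"
      using r by (intro mult_left_mono) auto
    moreover have "(R - r)\<^sup>2 > 0" using r by simp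
    ultimately show ?thesis by (simp add: power2_eq_square algebra_simps)
  qed
  have rR: "r\<^sup>2 \<le> R\<^sup>2" using r by (intro power_mono) auto
  have "((\<lambda>t. G (R * cis t) * of_real (k t)) has_integral 2 * pi * G (of_real (- r))) {0..2 * pi}"
    using Poisson_integral[OF G, of "- r" R] r by (simp add: k_def)
  from has_integral_linear[OF this bounded_linear_Re]
  have "((\<lambda>t. g t * k t) has_integral 2 * pi * Re (G (- of_real r))) {0..2 * pi}"
    by (simp add: o_def G_def g_def cis_mult mult.assoc)
  moreover have "cis (\<theta> - pi) = - cis \<theta>"
    by (simp add: complex_eq_iff cos_diff sin_diff)
  then have "G (- of_real r) = F (complex_of_real r * cis \<theta>)"
    by (simp add: G_def)
  ultimately have I: "integral {0..2 * pi} (\<lambda>t. g t * k t) = 2 * pi * Re (F (complex_of_real r * cis \<theta>))"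
    by (simp add: integral_unique)
  \<comment> \<open>The full period is written as the arc with centre and half-length both
    \<open>pi\<close>, to match the kernel bound.\<close>
  have "integral {pi - pi..pi + pi} (\<lambda>t. g t * k t) \<le> N * k pi"
  proof (rule symmetric_kernel_bound)
    show "continuous_on UNIV g"
      unfolding g_def using r
      by (intro continuous_intros continuous_on_holomorphic_slice F) auto
    show "(k has_real_derivative k' t) (at t)" for t
      unfolding k_def k'_def using den[of t]
      by (auto intro!: derivative_eq_intros simp: power2_eq_square)
    show "k (pi - s) = k (pi + s)" for s
      by (simp add: k_def)
    show "k' (pi + s) \<le> 0" if "0 \<le> s" "s \<le> pi" for s
      using that r rR sin_ge_zero[of s] unfolding k'_def
      by (auto intro!: divide_nonpos_nonneg mult_nonneg_nonneg)
    show "0 \<le> k (pi + pi)"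
      using den[of "pi + pi"] rR unfolding k_def by (intro divide_nonneg_pos) auto
    fix s :: real assume s: "0 \<le> s" "s \<le> pi"
    have "integral {pi - s..pi + s} g
        = integral {pi - s + (\<theta> - pi)..pi + s + (\<theta> - pi)} (\<lambda>t. Re (F (complex_of_real R * cis t)))"
      unfolding g_def
      using integral_shift_real_ivl[of "pi - s + (\<theta> - pi)" "\<theta> - pi" "pi + s + (\<theta> - pi)"
        "\<lambda>t. Re (F (complex_of_real R * cis t))"] by (simp add: algebra_simps)
    then show "integral {pi - s..pi + s} g \<le> N"
      using N[OF s, of \<theta>] by (simp add: add.commute)
  qed auto
  moreover have "k pi = (R + r) / (R - r)"
  proof -
    have "R\<^sup>2 + 2 * R * r * cos pi + r\<^sup>2 = (R - r) * (R - r)"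
      by (simp add: power2_eq_square algebra_simps)
    moreover have "R\<^sup>2 - r\<^sup>2 = (R + r) * (R - r)"
      by (simp add: power2_eq_square algebra_simps)
    ultimately show ?thesis
      using r by (simp add: k_def)
  qed
  ultimately have "2 * pi * Re (F (complex_of_real r * cis \<theta>)) \<le> N * ((R + r) / (R - r))"
    using I by simp
  then show ?thesis
    by (subst pos_le_divide_eq) (simp_all add: mult.commute)
qed

text \<open>Arcs of half-length at most \<open>pi\<close> are admissible in the Alexiewicz norm, so
  the circle bound applies to \<open>F\<close> and \<open>- F\<close> on every radius
  \<open>R\<close> between \<open>r\<close> and \<open>1\<close>. Letting \<open>R\<close> tend to
  \<open>1\<close> gives the constant.\<close>

lemma harmonic_HK_bound:
  assumes u: "u \<in> h_HK" and r: "0 \<le> r" "r < 1"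
  shows "\<bar>circle_slice u r \<theta>\<bar> \<le> enn2real (HK_norm u) * ((1 + r) / (1 - r)) / (2 * pi)"
proof -
  define N where "N = enn2real (HK_norm u)"
  have N: "HK_norm u = ennreal N" "N \<ge> 0"
    using u by (simp_all add: N_def h_HK_def)
  have int: "\<bar>integral {a - s..a + s} (circle_slice u R)\<bar> \<le> N"
    if "0 \<le> s" "s \<le> pi" "0 \<le> R" "R < 1" for a s R
  proof -
    have "ennreal \<bar>integral {a - s..a + s} (circle_slice u R)\<bar> \<le> alexiewicz_norm (circle_slice u R)"
      unfolding alexiewicz_norm_def using that
      by (intro SUP_upper) (auto intro!: ennreal_leI)
    also have "\<dots> \<le> HK_norm u"
      unfolding HK_norm_def using that by (intro SUP_upper) auto
    finally show ?thesis
      using N by simp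
  qed
  have "harmonic_on (ball 0 1) u"
    using u by (simp add: h_HK_def)
  then obtain F where F: "F holomorphic_on ball 0 1" and uF: "\<And>z. z \<in> ball 0 1 \<Longrightarrow> u z = Re (F z)"
    using harmonic_on_imp_Re_holomorphic[OF open_ball convex_ball] by metis
  have slice: "circle_slice u R = (\<lambda>t. Re (F (complex_of_real R * cis t)))" if "0 \<le> R" "R < 1" for R
    using that uF by (auto simp: circle_slice_def norm_mult)
  have "\<bar>circle_slice u r \<theta>\<bar> \<le> N * ((R + r) / (R - r)) / (2 * pi)" if R: "r < R" "R < 1" for R
  proof -
    have R0: "0 \<le> R" using r R by simp
    have s: "\<bar>integral {a - s..a + s} (\<lambda>t. Re (F (complex_of_real R * cis t)))\<bar> \<le> N"
      if "0 \<le> s" "s \<le> pi" for a s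
      using int[OF that R0 R(2), of a] unfolding slice[OF R0 R(2)] .
    have "Re (F (complex_of_real r * cis \<theta>)) \<le> N * ((R + r) / (R - r)) / (2 * pi)"
      using s by (intro Re_holomorphic_circle_bound F r R) (simp add: abs_le_iff)
    moreover have "Re (- F (complex_of_real r * cis \<theta>)) \<le> N * ((R + r) / (R - r)) / (2 * pi)"
      using s by (intro Re_holomorphic_circle_bound[where F = "\<lambda>z. - F z"] F r R holomorphic_intros)
        (simp add: abs_le_iff)
    ultimately show ?thesis
      using slice[OF r] by (simp add: abs_le_iff)
  qed
  then have ev: "\<forall>\<^sub>F R in at_left 1. \<bar>circle_slice u r \<theta>\<bar> \<le> N * ((R + r) / (R - r)) / (2 * pi)"
    using r unfolding eventually_at_left_field by blast
  have "((\<lambda>R. N * ((R + r) / (R - r)) / (2 * pi)) \<longlongrightarrow> N * ((1 + r) / (1 - r)) / (2 * pi)) (at_left 1)"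
    using r by (intro tendsto_intros) auto
  from tendsto_lowerbound[OF this ev] show ?thesis
    by (simp add: N_def)
qed

lemma circle_slice_continuous:
  assumes u: "u \<in> h_HK" and r: "0 \<le> r" "r < 1"
  shows "continuous_on UNIV (circle_slice u r)"
proof -
  have "continuous_on (ball 0 1) u"
    using u by (auto simp: h_HK_def harmonic_on_def C2_on_def C1_on_def
      intro!: continuous_at_imp_continuous_on differentiable_imp_continuous_within)
  then have "continuous_on UNIV (\<lambda>\<theta>. u (complex_of_real r * cis \<theta>))"
    by (rule continuous_on_compose2) (use r in \<open>auto simp: norm_mult intro!: continuous_intros\<close>)
  then show ?thesis
    by (simp add: circle_slice_def[abs_def])
qed

text \<open>The factor \<open>c\<close> is left free so that both ranges of \<open>r\<close>, and
  the finiteness of the p-norm, follow from one statement.\<close>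

lemma Lp_norm_circle_slice_le:
  assumes p: "1 \<le> p" and u: "u \<in> h_HK" and r: "0 \<le> r" "r < 1"
    and c: "(1 + r) / (1 - r) / (2 * pi) \<le> c"
  shows "Lp_norm p (circle_slice u r) \<le> ennreal (two_pi_root p * c) * HK_norm u"
proof -
  define N where "N = enn2real (HK_norm u)"
  have N: "HK_norm u = ennreal N" "N \<ge> 0"
    using u by (simp_all add: N_def h_HK_def)
  have "\<bar>circle_slice u r \<theta>\<bar> \<le> c * N" for \<theta>
  proof -
    have "\<bar>circle_slice u r \<theta>\<bar> \<le> ((1 + r) / (1 - r) / (2 * pi)) * N"
      using harmonic_HK_bound[OF u r, of \<theta>] by (simp add: N_def mult.commute)
    also have "\<dots> \<le> c * N"
      using c N by (intro mult_right_mono)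
    finally show ?thesis .
  qed
  moreover have "circle_slice u r \<in> borel_measurable (lebesgue_on {-pi..pi})"
    using continuous_on_subset[OF circle_slice_continuous[OF u r]]
    by (intro continuous_imp_measurable_on_sets_lebesgue) auto
  ultimately have "Lp_norm p (circle_slice u r) \<le> ennreal (two_pi_root p * (c * N))"
    by (intro Lp_norm_le p)
  also have "\<dots> = ennreal (two_pi_root p * c) * ennreal N"
    using N(2) by (simp add: ennreal_mult'' mult.assoc[symmetric])
  finally show ?thesis by (simp add: N)
qed

subsection \<open>Sharpness\<close>

text \<open>This is Re (z g'(z)) for g(z) = sum_k 2^-k z^(n_k), in other words the angular
  derivative of Im g inside the disc.\<close>

definition lacunary_fun :: "(nat \<Rightarrow> nat) \<Rightarrow> complex \<Rightarrow> real" where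
  "lacunary_fun n z = Re (\<Sum>k. of_real ((1/2) ^ k * real (n k)) * z ^ n k)"

context
  fixes n :: "nat \<Rightarrow> nat"
  assumes n_pos: "\<And>k. 0 < n k"
begin

text \<open>The weights 2^-k sum to 2 and dominate the series of \<open>g\<close> on the whole disc,
  which bounds \<open>g\<close> and permits termwise differentiation. Multiplying by
  \<open>z\<close> restores the exponent \<open>n k\<close>, as it is positive.\<close>

lemma lacunary_primitive:
  obtains g where "g holomorphic_on ball 0 1"
    "\<And>z. z \<in> ball 0 1 \<Longrightarrow> norm (g z) \<le> 2"
    "\<And>z. z \<in> ball 0 1 \<Longrightarrow> (\<lambda>k. of_real ((1/2) ^ k * real (n k)) * z ^ n k) sums (z * deriv g z)"
proof -
  let ?f = "\<lambda>k z. of_real ((1/2) ^ k) * z ^ n k :: complex"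
  let ?f' = "\<lambda>k z. of_real ((1/2) ^ k) * (of_nat (n k) * z ^ (n k - 1)) :: complex"
  have h: "summable (\<lambda>k. (1/2) ^ k :: real)" by (simp add: summable_geometric)
  have bound: "norm (?f k z) \<le> (1/2) ^ k" if "z \<in> ball 0 1" for k z
    using that by (simp add: norm_mult norm_power norm_divide power_le_one mult_left_le divide_le_eq)
  have deriv: "((?f k) has_field_derivative ?f' k z) (at z)" for k z
    by (rule derivative_eq_intros refl)+ simp
  have ev: "\<forall>\<^sub>F k in sequentially. \<forall>z\<in>ball 0 1. norm (?f k z) \<le> (1/2) ^ k"
    using bound by (intro always_eventually allI ballI)
  obtain g g' where g: "\<forall>z \<in> ball 0 1. ((\<lambda>k. ?f k z) sums g z) \<and> ((\<lambda>k. ?f' k z) sums g' z) \<and>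
      (g has_field_derivative g' z) (at z)"
    by (rule series_and_derivative_comparison[OF open_ball h deriv ev])
  show ?thesis
  proof
    show "g holomorphic_on ball 0 1"
      using g by (auto simp: holomorphic_on_open)
    fix z :: complex assume z: "z \<in> ball 0 1"
    have gz: "(\<lambda>k. ?f k z) sums g z" "(\<lambda>k. ?f' k z) sums g' z" "deriv g z = g' z"
      using g z DERIV_imp_deriv by blast+
    have "norm (g z) \<le> (\<Sum>k. (1/2) ^ k :: real)"
      using norm_suminf_le[of "\<lambda>k. ?f k z", OF bound[OF z] h] sums_unique[OF gz(1)] by simp
    then show "norm (g z) \<le> 2"
      by (simp add: suminf_geometric)
    have eq: "z * ?f' k z = of_real ((1/2) ^ k * real (n k)) * z ^ n k" for k
      using power_minus_mult[OF n_pos, of z k] by (simp add: algebra_simps)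
    show "(\<lambda>k. of_real ((1/2) ^ k * real (n k)) * z ^ n k) sums (z * deriv g z)"
      using sums_mult[OF gz(2), of z] unfolding eq gz(3) .
  qed
qed

text \<open>On each circle the slice is the derivative of
  \<open>Im (g (complex_of_real r * cis t))\<close>, which is bounded by 2, so all its interval
  integrals are at most 4 in modulus, whatever the frequencies.\<close>

lemma lacunary_fun_in_h_HK: "lacunary_fun n \<in> h_HK"
  and lacunary_fun_sums: "\<lbrakk>0 \<le> r; r < 1\<rbrakk> \<Longrightarrow>
    (\<lambda>k. ((1/2) ^ k * real (n k) * r ^ n k) * cos (real (n k) * t)) sums circle_slice (lacunary_fun n) r t"
proof -
  obtain g where g: "g holomorphic_on ball 0 1"
    "\<And>z. z \<in> ball 0 1 \<Longrightarrow> norm (g z) \<le> 2"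
    "\<And>z. z \<in> ball 0 1 \<Longrightarrow> (\<lambda>k. of_real ((1/2) ^ k * real (n k)) * z ^ n k) sums (z * deriv g z)"
    using lacunary_primitive by blast
  have u: "lacunary_fun n z = Re (z * deriv g z)" if "z \<in> ball 0 1" for z
    using sums_unique[OF g(3)[OF that]] by (simp add: lacunary_fun_def)
  show "(\<lambda>k. ((1/2) ^ k * real (n k) * r ^ n k) * cos (real (n k) * t)) sums circle_slice (lacunary_fun n) r t"
    if r: "0 \<le> r" "r < 1" for r t
  proof -
    have z: "complex_of_real r * cis t \<in> ball 0 1" using r by (simp add: norm_mult)
    have eq: "Re (of_real ((1/2) ^ k * real (n k)) * (complex_of_real r * cis t) ^ n k)
       = ((1/2) ^ k * real (n k) * r ^ n k) * cos (real (n k) * t)" for k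
    proof -
      have "of_real ((1/2) ^ k * real (n k)) * (complex_of_real r * cis t) ^ n k
        = of_real ((1/2) ^ k * real (n k) * r ^ n k) * cis (real (n k) * t)"
        by (simp add: power_mult_distrib Complex.DeMoivre)
      then show ?thesis
        by (simp only: Re_complex_of_real Im_complex_of_real times_complex.simps cis.simps)
    qed
    show ?thesis
      using sums_Re[OF g(3)[OF z]] unfolding eq circle_slice_def u[OF z] .
  qed
  have hol: "(\<lambda>z. z * deriv g z) holomorphic_on ball 0 1"
    by (intro holomorphic_intros holomorphic_deriv g) auto
  have harm: "harmonic_on (ball 0 1) (lacunary_fun n)"
    by (rule Re_holomorphic_harmonic_on[OF hol open_ball u])
  have "HK_norm (lacunary_fun n) \<le> ennreal 4"
    unfolding HK_norm_def alexiewicz_norm_def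
  proof (safe intro!: SUP_least ennreal_leI)
    fix r :: real and I :: "real set"
    assume r: "r \<in> {0..<1}" and I: "is_interval I" "emeasure lborel I \<le> ennreal (2 * pi)"
    have z: "complex_of_real r * cis t \<in> ball 0 1" for t using r by (simp add: norm_mult)
    have "\<bar>integral I (circle_slice (lacunary_fun n) r)\<bar> \<le> 2 * 2"
    proof (rule abs_integral_interval_le[OF I, where G = "\<lambda>t. Im (g (complex_of_real r * cis t))"])
      show "((\<lambda>t. Im (g (complex_of_real r * cis t))) has_real_derivative circle_slice (lacunary_fun n) r t) (at t)" for t
      proof -
        have "((\<lambda>t. complex_of_real r * cis t) has_vector_derivative of_real r * (\<i> * cis t)) (at t)"
          by (auto simp: has_vector_derivative_def intro!: derivative_eq_intros)
        from field_vector_diff_chain_at[OF this holomorphic_derivI[OF g(1) open_ball z]]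
        have "((\<lambda>t. g (complex_of_real r * cis t)) has_vector_derivative
          of_real r * (\<i> * cis t) * deriv g (of_real r * cis t)) (at t)"
          by (simp add: o_def)
        from bounded_linear.has_vector_derivative[OF bounded_linear_Im this]
        have "((\<lambda>t. Im (g (complex_of_real r * cis t))) has_vector_derivative
          Im (of_real r * (\<i> * cis t) * deriv g (of_real r * cis t))) (at t)" .
        moreover have "Im (of_real r * (\<i> * cis t) * deriv g (of_real r * cis t))
          = circle_slice (lacunary_fun n) r t"
          unfolding circle_slice_def u[OF z] by (simp add: algebra_simps)
        ultimately show ?thesis
          by (simp only: has_real_derivative_iff_has_vector_derivative)
      qed
      show "\<bar>Im (g (complex_of_real r * cis t))\<bar> \<le> 2" for t
        using g(2)[OF z] abs_Im_le_cmod order_trans by blast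
    qed
    then show "\<bar>integral I (circle_slice (lacunary_fun n) r)\<bar> \<le> 4" by simp
  qed
  then have "HK_norm (lacunary_fun n) < \<infinity>"
    using ennreal_less_top le_less_trans by fastforce
  with harm show "lacunary_fun n \<in> h_HK"
    by (simp add: h_HK_def)
qed

text \<open>Pairing with the \<open>m\<close>-th cosine, of modulus at most 1, bounds the integral
  below by pi times the \<open>m\<close>-th coefficient. The radius is chosen so that its damping
  factor \<open>r ^ n m\<close> is at least 1/2.\<close>

lemma lacunary_fun_integral_ge:
  fixes m :: nat
  assumes n: "inj n"
  defines "r \<equiv> 1 - 1 / (2 * real (n m))"
  shows "integral {-pi..pi} (\<lambda>t. \<bar>circle_slice (lacunary_fun n) r t\<bar>) \<ge> pi * ((1/2) ^ m * real (n m)) / 2"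
proof -
  let ?U = "circle_slice (lacunary_fun n) r"
  let ?c = "\<lambda>k. (1/2) ^ k * real (n k) * r ^ n k"
  have n1: "real (n m) \<ge> 1" using n_pos[of m] by simp
  then have r: "0 \<le> r" "r < 1"
    by (auto simp: r_def field_simps)
  \<comment> \<open>At \<open>t = 0\<close> every cosine equals 1, so convergence there is
    summability of the coefficients.\<close>
  have "summable ?c"
    using lacunary_fun_sums[OF r, of 0] by (simp add: sums_iff)
  then have c: "summable (\<lambda>k. \<bar>?c k\<bar>)"
    using r by (simp add: abs_mult)
  note U = cos_series_coefficient[OF n n_pos c lacunary_fun_sums[OF r]]
  have contU: "continuous_on {-pi..pi} ?U"
    using U(1) continuous_on_subset by blast
  \<comment> \<open>Bernoulli: (1 - 1/(2N))^N is at least 1 - N/(2N).\<close>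
  have "1 / 2 \<le> r ^ n m"
    using Bernoulli_inequality[of "- 1 / (2 * real (n m))" "n m"] n1
    by (simp add: r_def field_simps)
  then have "pi * ((1/2) ^ m * real (n m)) / 2 \<le> pi * ?c m"
    using mult_left_mono[of "1/2" "r ^ n m" "pi * ((1/2) ^ m * real (n m))"] by (simp add: mult.assoc)
  also have "\<dots> = integral {-pi..pi} (\<lambda>t. ?U t * cos (real (n m) * t))"
    by (rule U(2)[symmetric])
  also have "\<dots> \<le> integral {-pi..pi} (\<lambda>t. \<bar>?U t\<bar>)"
  proof (rule integral_le)
    show "(\<lambda>t. ?U t * cos (real (n m) * t)) integrable_on {-pi..pi}" "(\<lambda>t. \<bar>?U t\<bar>) integrable_on {-pi..pi}"
      by (intro integrable_continuous_real continuous_intros contU)+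
    fix t :: real
    have "?U t * cos (real (n m) * t) \<le> \<bar>?U t\<bar> * \<bar>cos (real (n m) * t)\<bar>"
      by (metis abs_ge_self abs_mult)
    also have "\<dots> \<le> \<bar>?U t\<bar>"
      by (simp add: mult_left_le)
    finally show "?U t * cos (real (n m) * t) \<le> \<bar>?U t\<bar>" .
  qed
  finally show ?thesis .
qed

end

section \<open>Choice of frequencies and the contradiction\<close>

text \<open>At \<open>r = 1 - 1 / (2 * real j)\<close> the comparison function 1 / (1 - r) equals
  2j, so for each \<open>k\<close> smallness with constant 2^-k yields a threshold
  \<open>K k\<close> beyond which every \<open>j\<close> qualifies.\<close>

lemma exists_frequencies:
  fixes \<psi> :: "real \<Rightarrow> real"
  assumes "\<psi> \<in> o[at_left 1](\<lambda>r. 1 / (1 - r))"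
  obtains n :: "nat \<Rightarrow> nat" where "strict_mono n" "\<And>k. 0 < n k"
    "\<And>k. \<psi> (1 - 1 / (2 * real (n k))) \<le> (1/2) ^ k * (2 * real (n k))"
proof -
  have lim: "filterlim (\<lambda>j. 1 - 1 / (2 * real j)) (at_left 1) sequentially"
    unfolding filterlim_at
  proof
    show "\<forall>\<^sub>F j in sequentially. 1 - 1 / (2 * real j) \<in> {..<1} \<and> 1 - 1 / (2 * real j) \<noteq> 1"
      using eventually_gt_at_top[of 0] by eventually_elim auto
    show "(\<lambda>j. 1 - 1 / (2 * real j)) \<longlonglongrightarrow> 1"
      using tendsto_diff[OF tendsto_const[of 1] tendsto_mult[OF tendsto_const[of "1/2"] lim_1_over_n]]
      by simp
  qed
  have "\<exists>K. \<forall>j\<ge>K. \<psi> (1 - 1 / (2 * real j)) \<le> (1/2) ^ k * (2 * real j)" for k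
  proof -
    have "\<forall>\<^sub>F r in at_left 1. norm (\<psi> r) \<le> (1/2) ^ k * norm (1 / (1 - r))"
      using landau_o.smallD[OF assms] by simp
    then have "\<forall>\<^sub>F j in sequentially. norm (\<psi> (1 - 1 / (2 * real j))) \<le> (1/2) ^ k * norm (1 / (1 - (1 - 1 / (2 * real j))))"
      using lim by (rule eventually_compose_filterlim)
    then have "\<forall>\<^sub>F j in sequentially. \<psi> (1 - 1 / (2 * real j)) \<le> (1/2) ^ k * (2 * real j)"
      by (rule eventually_mono) auto
    then show ?thesis
      by (simp add: eventually_sequentially)
  qed
  then obtain K where K: "\<And>k j. j \<ge> K k \<Longrightarrow> \<psi> (1 - 1 / (2 * real j)) \<le> (1/2) ^ k * (2 * real j)"
    by metis
  \<comment> \<open>The sum dominates \<open>K k\<close>; the summand \<open>Suc k\<close> makes the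
    sequence positive and strictly increasing.\<close>
  define n where "n = (\<lambda>k. Suc k + (\<Sum>j\<le>k. K j))"
  show ?thesis
  proof
    show "strict_mono n"
      by (rule strict_monoI_Suc) (simp add: n_def)
    show "0 < n k" for k by (simp add: n_def)
    have "n k \<ge> K k" for k
      unfolding n_def using member_le_sum[of k "{..k}" K] by simp
    then show "\<psi> (1 - 1 / (2 * real (n k))) \<le> (1/2) ^ k * (2 * real (n k))" for k
      by (rule K)
  qed
qed

lemma Lp_norm_growth_sharp:
  fixes \<psi> :: "real \<Rightarrow> real"
  assumes p: "1 \<le> p" and \<psi>_pos: "\<And>r. r \<in> {0..<1} \<Longrightarrow> 0 < \<psi> r"
    and \<psi>: "\<psi> \<in> o[at_left 1](\<lambda>r. 1 / (1 - r))"
  shows "\<exists>u\<in>h_HK. (\<lambda>r. enn2real (Lp_norm p (circle_slice u r))) \<notin> o[at_left 1](\<psi>)"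
proof -
  obtain n where n: "strict_mono n" "\<And>k. 0 < n k"
    "\<And>k. \<psi> (1 - 1 / (2 * real (n k))) \<le> (1/2) ^ k * (2 * real (n k))"
    using exists_frequencies[OF \<psi>] by blast
  let ?u = "lacunary_fun n"
  have u: "?u \<in> h_HK" by (rule lacunary_fun_in_h_HK[OF n(2)])
  have "(\<lambda>r. enn2real (Lp_norm p (circle_slice ?u r))) \<notin> o[at_left 1](\<psi>)"
  proof
    assume "(\<lambda>r. enn2real (Lp_norm p (circle_slice ?u r))) \<in> o[at_left 1](\<psi>)"
    \<comment> \<open>With X = 2^-m n_m, the constant 1/32 turns the comparison with the 1-norm into
      pi X / 2 \<le> pi \<psi>(r) / 8, that is 4 X \<le> \<psi>(r). The frequencies were chosen with
      \<psi>(r) \<le> 2 X, which is impossible for positive \<psi>(r).\<close>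
    then have "\<forall>\<^sub>F r in at_left 1. enn2real (Lp_norm p (circle_slice ?u r)) \<le> 1/32 * \<bar>\<psi> r\<bar>"
      using landau_o.smallD[of _ _ _ "1/32"] by fastforce
    then obtain b where b: "b < 1" "\<And>r. \<lbrakk>b < r; r < 1\<rbrakk> \<Longrightarrow> enn2real (Lp_norm p (circle_slice ?u r)) \<le> 1/32 * \<bar>\<psi> r\<bar>"
      by (auto simp: eventually_at_left_field)
    \<comment> \<open>Since \<open>n m \<ge> m\<close>, this choice puts the radius belonging to
      \<open>m\<close> beyond \<open>b\<close>.\<close>
    obtain m :: nat where m: "1 / (1 - b) < real m"
      using reals_Archimedean2 by blast
    have nm: "m \<le> n m" by (rule strict_mono_imp_increasing[OF n(1)])
    define r where "r = 1 - 1 / (2 * real (n m))"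
    have "1 / (1 - b) < 2 * real (n m)"
      using m nm by linarith
    then have "1 / (2 * real (n m)) < 1 - b"
      using b(1) n(2)[of m] by (simp add: field_simps)
    then have r: "b < r" "0 \<le> r" "r < 1"
      using n(2)[of m] by (auto simp: r_def field_simps)
    have pos: "0 < \<psi> r" using \<psi>_pos r by simp
    \<comment> \<open>Finiteness must be checked because \<open>enn2real\<close> sends
      \<open>\<infinity>\<close> to \<open>0\<close>, so a bound on the real value alone would say
      nothing.\<close>
    have "Lp_norm p (circle_slice ?u r) \<noteq> \<infinity>"
      using Lp_norm_circle_slice_le[OF p u r(2,3) order_refl] u
      by (auto simp: h_HK_def top_unique ennreal_mult_eq_top_iff)
    then have "Lp_norm p (circle_slice ?u r) \<le> ennreal (\<psi> r / 32)"
      using b(2)[OF r(1,3)] pos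
      by (metis ennreal_enn2real ennreal_leI infinity_ennreal_def less_top abs_of_pos mult.left_neutral times_divide_eq_left)
    then have "integral {-pi..pi} (\<lambda>t. \<bar>circle_slice ?u r t\<bar>) \<le> 4 * pi * (\<psi> r / 32)"
      using pos circle_slice_continuous[OF u r(2,3)]
      by (intro integral_abs_le_Lp_norm[OF p]) (auto intro: continuous_on_subset)
    moreover have "pi * ((1/2) ^ m * real (n m)) / 2 \<le> integral {-pi..pi} (\<lambda>t. \<bar>circle_slice ?u r t\<bar>)"
      unfolding r_def by (rule lacunary_fun_integral_ge[OF n(2) strict_mono_imp_inj_on[OF n(1)]])
    ultimately have "pi * ((1/2) ^ m * real (n m)) / 2 \<le> 4 * pi * (\<psi> r / 32)"
      by linarith
    then have "4 * ((1/2) ^ m * real (n m)) \<le> \<psi> r"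
      using pi_gt_zero by (simp add: field_simps)
    with n(3)[of m] pos show False
      by (simp add: r_def)
  qed
  with u show ?thesis by blast
qed

theorem theorem5:
  fixes p :: ennreal
  assumes "1 \<le> p"
  shows "(\<forall>u\<in>h_HK.
            (\<forall>r\<in>{1/2..<1}. Lp_norm p (circle_slice u r)
               \<le> ennreal (two_pi_root p * (2 * r / (pi * (1 - r)))) * HK_norm u) \<and>
            (\<forall>r\<in>{0..1/2}. Lp_norm p (circle_slice u r)
               \<le> ennreal (two_pi_root p * (2 / pi)) * HK_norm u))
       \<and> (\<forall>\<psi> :: real \<Rightarrow> real.
            (\<forall>r\<in>{0..<1}. \<psi> r > 0) \<and> \<psi> \<in> o[at_left 1](\<lambda>r. 1 / (1 - r)) \<longrightarrow>
            (\<exists>u\<in>h_HK. (\<lambda>r. enn2real (Lp_norm p (circle_slice u r))) \<notin> o[at_left 1](\<psi>)))"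
proof (intro conjI ballI allI impI)
  fix u r assume u: "u \<in> h_HK" and r: "r \<in> {1/2..<1::real}"
  \<comment> \<open>For \<open>r\<close> at least 1/3, and so here, 1 + r \<le> 4 r.\<close>
  have "(1 + r) / (1 - r) / (2 * pi) \<le> (4 * r) / (1 - r) / (2 * pi)"
    using r by (intro divide_right_mono) auto
  also have "\<dots> = 2 * r / (pi * (1 - r))"
    by (simp add: mult.commute)
  finally show "Lp_norm p (circle_slice u r) \<le> ennreal (two_pi_root p * (2 * r / (pi * (1 - r)))) * HK_norm u"
    using r by (intro Lp_norm_circle_slice_le assms u) auto
next
  fix u r assume u: "u \<in> h_HK" and r: "r \<in> {0..1/2::real}"
  \<comment> \<open>The quotient increases with \<open>r\<close> and equals 3 at 1/2; the value 4
    matches the claimed constant 4 / (2 pi).\<close>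
  have "(1 + r) / (1 - r) \<le> 4"
    using r by (simp add: divide_le_eq)
  from divide_right_mono[OF this, of "2 * pi"]
  have "(1 + r) / (1 - r) / (2 * pi) \<le> 2 / pi"
    by simp
  then show "Lp_norm p (circle_slice u r) \<le> ennreal (two_pi_root p * (2 / pi)) * HK_norm u"
    using r by (intro Lp_norm_circle_slice_le assms u) auto
next
  fix \<psi> :: "real \<Rightarrow> real"
  assume "(\<forall>r\<in>{0..<1}. \<psi> r > 0) \<and> \<psi> \<in> o[at_left 1](\<lambda>r. 1 / (1 - r))"
  then show "\<exists>u\<in>h_HK. (\<lambda>r. enn2real (Lp_norm p (circle_slice u r))) \<notin> o[at_left 1](\<psi>)"
    using Lp_norm_growth_sharp[OF assms] by blast
qed

end
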